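(* Let $X,Y\in\mathcal{M}$ be two different points of the Gromov--Hausdorff space, i.e. two non-isometric compact metric spaces. Then the metric segment $[X,Y]=\{Z\in\mathcal{M}: d_{GH}(X,Z)+d_{GH}(Z,Y)=d_{GH}(X,Y)\}$ is not a compact subset of the metric space $(\mathcal{M},d_{GH})$.
   Context: $\mathcal{M}$ denotes the Gromov--Hausdorff space, i.e. the set of isometry classes of non-empty compact metric spaces endowed with the Gromov--Hausdorff distance $d_{GH}$, which is a metric on $\mathcal{M}$. Here $d_{GH}(X,Y)$ is the infimum of those $r$ for which there exist a metric space $W$ and subsets $X',Y'\subset W$ isometric to $X$ and $Y$ respectively with Hausdorff distance $d_H(X',Y')\le r$, where $d_H(A,B)=\max\{\sup_{a\in A}\inf_{b\in B}|ab|,\ \sup_{b\in B}\inf_{a\in A}|ab|\}$. *)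

theory Defs
  imports "HOL-Analysis.Analysis"
begin

section \<open>Isometries, the Hausdorff distance and the Gromov--Hausdorff distance\<close>

definition isometric :: "'a metric \<Rightarrow> 'b metric \<Rightarrow> bool" where
  "isometric X Y \<longleftrightarrow>
     (\<exists>f. bij_betw f (mspace X) (mspace Y) \<and>
          (\<forall>x\<in>mspace X. \<forall>x'\<in>mspace X. mdist Y (f x) (f x') = mdist X x x'))"

definition compact_metric :: "'a metric \<Rightarrow> bool" where
  "compact_metric X \<longleftrightarrow> mspace X \<noteq> {} \<and> compact_space (mtopology_of X)"

text \<open>The suprema and infima are taken in the reals, so this is the usual Hausdorff distance
  only if both sets are non-empty and bounded; it is used for compact sets only.\<close>

definition hausdorff_dist :: "'w metric \<Rightarrow> 'w set \<Rightarrow> 'w set \<Rightarrow> real" where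
  "hausdorff_dist W A B =
     max (SUP a\<in>A. INF b\<in>B. mdist W a b) (SUP b\<in>B. INF a\<in>A. mdist W a b)"

definition gh_realizable ::
    "'w metric \<Rightarrow> 'a metric \<Rightarrow> 'b metric \<Rightarrow> real \<Rightarrow> bool" where
  "gh_realizable W X Y r \<longleftrightarrow>
     (\<exists>A B. A \<subseteq> mspace W \<and> B \<subseteq> mspace W \<and>
        isometric (submetric W A) X \<and> isometric (submetric W B) Y \<and>
        hausdorff_dist W A B \<le> r)"

text \<open>An ambient space \<open>W\<close> may be replaced by the union of the copies of \<open>X\<close> and \<open>Y\<close> in it, which
  injects into the sum type. So nothing is lost by letting \<open>W\<close> range over metrics on the sum type;
  see lemma \<open>gh_realizable_sum_type\<close>.\<close>

definition gh_distance :: "'a metric \<Rightarrow> 'b metric \<Rightarrow> real" where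
  "gh_distance X Y = Inf {r. \<exists>W :: ('a + 'b) metric. gh_realizable W X Y r}"


subsection \<open>Elementary facts\<close>

lemma isometric_refl: "isometric X X"
  unfolding isometric_def by (intro exI[of _ id]) auto

lemma isometric_sym:
  assumes "isometric X Y" shows "isometric Y X"
proof -
  obtain f where f: "bij_betw f (mspace X) (mspace Y)"
    and d: "\<And>x x'. \<lbrakk>x \<in> mspace X; x' \<in> mspace X\<rbrakk> \<Longrightarrow> mdist Y (f x) (f x') = mdist X x x'"
    using assms unfolding isometric_def by blast
  let ?g = "inv_into (mspace X) f"
  have g: "bij_betw ?g (mspace Y) (mspace X)" by (rule bij_betw_inv_into[OF f])
  have "mdist X (?g y) (?g y') = mdist Y y y'" if "y \<in> mspace Y" "y' \<in> mspace Y" for y y'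
    using d[of "?g y" "?g y'"] that bij_betwE[OF g] bij_betw_inv_into_right[OF f] by metis
  with g show ?thesis unfolding isometric_def by blast
qed

lemma isometric_trans:
  assumes "isometric X Y" "isometric Y Z" shows "isometric X Z"
proof -
  obtain f where f: "bij_betw f (mspace X) (mspace Y)"
    and d: "\<And>x x'. \<lbrakk>x \<in> mspace X; x' \<in> mspace X\<rbrakk> \<Longrightarrow> mdist Y (f x) (f x') = mdist X x x'"
    using assms(1) unfolding isometric_def by blast
  obtain g where g: "bij_betw g (mspace Y) (mspace Z)"
    and e: "\<And>x x'. \<lbrakk>x \<in> mspace Y; x' \<in> mspace Y\<rbrakk> \<Longrightarrow> mdist Z (g x) (g x') = mdist Y x x'"
    using assms(2) unfolding isometric_def by blast
  show ?thesis unfolding isometric_def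
    by (rule exI[of _ "g \<circ> f"]) (use bij_betw_trans[OF f g] bij_betwE[OF f] d e in auto)
qed

lemma isometric_compact_metric:
  assumes "isometric X Y" "compact_metric X" shows "compact_metric Y"
proof -
  obtain f where f: "bij_betw f (mspace X) (mspace Y)"
    and d: "\<And>x x'. \<lbrakk>x \<in> mspace X; x' \<in> mspace X\<rbrakk> \<Longrightarrow> mdist Y (f x) (f x') = mdist X x x'"
    using assms unfolding isometric_def by blast
  interpret Metric_space12 "mspace X" "mdist X" "mspace Y" "mdist Y"
    by (simp add: Metric_space12_def)
  have "homeomorphic_map (mtopology_of X) (mtopology_of Y) f"
    unfolding mtopology_of_def
    by (rule isometry_imp_homeomorphic_map) (use f d in \<open>auto simp: bij_betw_def\<close>)
  then have "mtopology_of X homeomorphic_space mtopology_of Y"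
    by (rule homeomorphic_map_imp_homeomorphic_space)
  then show ?thesis
    using assms(2) f unfolding compact_metric_def
    by (auto simp: homeomorphic_compact_space bij_betw_def)
qed

lemma metric_transport:
  fixes X :: "'a metric" and h :: "'a \<Rightarrow> 'b"
  assumes inj: "inj_on h (mspace X)"
  obtains Y :: "'b metric" where "mspace Y = h ` mspace X"
    and "\<And>x x'. \<lbrakk>x \<in> mspace X; x' \<in> mspace X\<rbrakk> \<Longrightarrow> mdist Y (h x) (h x') = mdist X x x'"
proof -
  let ?g = "inv_into (mspace X) h"
  let ?d = "\<lambda>u v. mdist X (?g u) (?g v)"
  interpret Y: Metric_space "h ` mspace X" ?d
    by unfold_locales (use inj in \<open>auto simp: mdist_commute mdist_triangle\<close>)
  show ?thesis
    by (rule that[of "metric (h ` mspace X, ?d)"]) (use inj in auto)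
qed

text \<open>Every compact metric space is isometric to one whose points are real numbers, because it has
  at most the cardinality of the continuum.\<close>

lemma compact_metric_isometric_real:
  fixes X :: "'a metric"
  assumes "compact_metric X"
  obtains Y :: "real metric" where "compact_metric Y" "isometric X Y"
proof -
  interpret X: Metric_space "mspace X" "mdist X" by simp
  have "X.mtotally_bounded (mspace X)"
    using assms X.compactin_imp_mtotally_bounded[of "mspace X"]
    by (simp add: compact_metric_def compact_space_def mtopology_of_def)
  then have "\<forall>n. \<exists>K. finite K \<and> K \<subseteq> mspace X \<and>
       mspace X \<subseteq> (\<Union>x\<in>K. X.mball x (1 / real (Suc n)))"
    unfolding X.mtotally_bounded_def by (metis divide_pos_pos of_nat_0_less_iff zero_less_Suc zero_less_one)
  then obtain K where K: "\<And>n. finite (K n)" "\<And>n. K n \<subseteq> mspace X"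
    "\<And>n. mspace X \<subseteq> (\<Union>x\<in>K n. X.mball x (1 / real (Suc n)))" by metis
  define D where "D = (\<Union>n. K n)"
  have cD: "countable (D \<times> (UNIV :: nat set))" unfolding D_def using K(1) by (auto intro: countable_finite)
  let ?t = "to_nat_on (D \<times> (UNIV :: nat set))"
  define c where "c x = {p \<in> D \<times> (UNIV :: nat set). mdist X (fst p) x < 1 / real (Suc (snd p))}" for x
  have "inj_on c (mspace X)"
  proof (rule inj_onI, rule ccontr)
    fix x y assume xy: "x \<in> mspace X" "y \<in> mspace X" "c x = c y" "x \<noteq> y"
    then have "mdist X x y / 2 > 0" by simp
    then obtain n where n: "1 / real (Suc n) < mdist X x y / 2"
      using nat_approx_posE by metis
    obtain k where k: "k \<in> K n" "mdist X k x < 1 / real (Suc n)"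
      using K(3)[of n] xy(1) by auto
    then have "(k, n) \<in> c x" by (auto simp: c_def D_def)
    then have "(k, n) \<in> c y" using xy(3) by simp
    then have "mdist X k y < 1 / real (Suc n)" by (simp add: c_def)
    moreover have "mdist X x y \<le> mdist X k x + mdist X k y"
      using mdist_triangle[of x X k y] xy k K(2)[of n] by (auto simp: mdist_commute)
    ultimately show False using k n by linarith
  qed
  moreover have "inj_on (image ?t) (c ` mspace X)"
    using inj_on_image_Pow[OF inj_on_to_nat_on[OF cD]]
    by (rule inj_on_subset) (auto simp: c_def)
  moreover obtain e :: "nat set \<Rightarrow> real" where "inj e"
    using nat_sets_eqpoll_reals unfolding eqpoll_def by (auto simp: bij_betw_def)
  ultimately have "inj_on (e \<circ> (image ?t \<circ> c)) (mspace X)"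
    by (meson comp_inj_on inj_on_subset subset_UNIV)
  then obtain Y :: "real metric" where Y: "mspace Y = (e \<circ> (image ?t \<circ> c)) ` mspace X"
    "\<And>x x'. \<lbrakk>x \<in> mspace X; x' \<in> mspace X\<rbrakk> \<Longrightarrow>
       mdist Y ((e \<circ> (image ?t \<circ> c)) x) ((e \<circ> (image ?t \<circ> c)) x') = mdist X x x'"
    by (rule metric_transport) blast
  have "isometric X Y"
    unfolding isometric_def
    by (rule exI[of _ "e \<circ> (image ?t \<circ> c)"])
      (use Y \<open>inj_on (e \<circ> (image ?t \<circ> c)) (mspace X)\<close> in \<open>auto simp: bij_betw_def\<close>)
  with that isometric_compact_metric assms show thesis by blast
qed

lemma gh_realizable_sum_type:
  fixes W :: "'w metric" and X :: "'a metric" and Y :: "'b metric"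
  assumes "gh_realizable W X Y r"
  shows "\<exists>W' :: ('a + 'b) metric. gh_realizable W' X Y r"
proof -
  obtain A B where AB: "A \<subseteq> mspace W" "B \<subseteq> mspace W" "hausdorff_dist W A B \<le> r"
    and iso: "isometric (submetric W A) X" "isometric (submetric W B) Y"
    using assms unfolding gh_realizable_def by blast
  obtain f :: "'w \<Rightarrow> 'a" where f: "inj_on f A"
    using iso(1) AB unfolding isometric_def by (auto simp: bij_betw_def Int_absorb2)
  obtain g :: "'w \<Rightarrow> 'b" where g: "inj_on g B"
    using iso(2) AB unfolding isometric_def by (auto simp: bij_betw_def Int_absorb2)
  define h where "h w = (if w \<in> A then Inl (f w) else Inr (g w))" for w
  have h: "inj_on h (mspace (submetric W (A \<union> B)))"
    using f g by (auto simp: inj_on_def h_def)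
  obtain W' :: "('a + 'b) metric" where W': "mspace W' = h ` mspace (submetric W (A \<union> B))"
    "\<And>x x'. \<lbrakk>x \<in> mspace (submetric W (A \<union> B)); x' \<in> mspace (submetric W (A \<union> B))\<rbrakk> \<Longrightarrow>
       mdist W' (h x) (h x') = mdist (submetric W (A \<union> B)) x x'"
    using metric_transport[OF h] by metis
  have d: "mdist W' (h x) (h x') = mdist W x x'" if "x \<in> A \<union> B" "x' \<in> A \<union> B" for x x'
    using W'(2)[of x x'] that AB by auto
  have sub: "h ` A \<subseteq> mspace W'" "h ` B \<subseteq> mspace W'" using W'(1) AB by auto
  have iso': "isometric (submetric W' (h ` C)) (submetric W C)" if "C \<subseteq> A \<union> B" for C
  proof (rule isometric_sym)
    have "h ` C \<subseteq> mspace W'" "C \<subseteq> mspace W" "inj_on h C"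
      using that AB W'(1) h by (auto intro: inj_on_subset)
    then show "isometric (submetric W C) (submetric W' (h ` C))"
      unfolding isometric_def
      by (intro exI[of _ h]) (use d that in \<open>auto simp: bij_betw_def Int_absorb2 subset_iff\<close>)
  qed
  have "hausdorff_dist W' (h ` A) (h ` B) = hausdorff_dist W A B"
    unfolding hausdorff_dist_def image_image
    by (intro arg_cong2[where f = max] SUP_cong INF_cong refl) (auto simp: d)
  then show ?thesis
    unfolding gh_realizable_def
    using AB sub iso iso'[of A] iso'[of B] isometric_trans by (metis Un_upper1 Un_upper2)
qed

lemma gh_realizable_isometric:
  assumes "gh_realizable W X Y r" "isometric X X'" "isometric Y Y'"
  shows "gh_realizable W X' Y' r"
  using assms isometric_trans unfolding gh_realizable_def by metis

lemma gh_distance_isometric: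
  fixes X X' :: "'a metric" and Y Y' :: "'b metric"
  assumes "isometric X X'" "isometric Y Y'"
  shows "gh_distance X Y = gh_distance X' Y'"
  unfolding gh_distance_def
  by (metis (lifting) gh_realizable_isometric assms isometric_sym)


subsection \<open>Correspondences\<close>

definition correspondence :: "'a metric \<Rightarrow> 'b metric \<Rightarrow> real \<Rightarrow> ('a \<times> 'b) set \<Rightarrow> bool" where
  "correspondence X Y e R \<longleftrightarrow> R \<subseteq> mspace X \<times> mspace Y \<and>
     fst ` R = mspace X \<and> snd ` R = mspace Y \<and>
     (\<forall>x y x' y'. (x, y) \<in> R \<longrightarrow> (x', y') \<in> R \<longrightarrow> \<bar>mdist X x x' - mdist Y y y'\<bar> \<le> e)"

lemma compact_metric_bounded:
  assumes "compact_metric X"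
  obtains K where "K > 0" "\<forall>x\<in>mspace X. \<forall>x'\<in>mspace X. mdist X x x' \<le> K"
proof -
  interpret X: Metric_space "mspace X" "mdist X" by simp
  have "X.mbounded (mspace X)"
    using assms X.compactin_imp_mbounded[of "mspace X"]
    by (simp add: compact_metric_def compact_space_def mtopology_of_def)
  then obtain K where "\<forall>x\<in>mspace X. \<forall>x'\<in>mspace X. mdist X x x' \<le> K"
    unfolding X.mbounded_alt by blast
  then show ?thesis by (intro that[of "max K 1"]) (auto simp: le_max_iff_disj)
qed

lemma hausdorff_dist_bdd:
  assumes "A \<subseteq> mspace W" "B \<subseteq> mspace W" "B \<noteq> {}"
    and K: "\<forall>a\<in>A. \<forall>a'\<in>A. mdist W a a' \<le> K"
  shows "bdd_above ((\<lambda>a. INF b\<in>B. mdist W a b) ` A)"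
proof (cases "A = {}")
  case False
  then obtain a0 b0 where ab: "a0 \<in> A" "b0 \<in> B" using assms by blast
  have "(INF b\<in>B. mdist W a b) \<le> K + mdist W a0 b0" if "a \<in> A" for a
  proof -
    have "(INF b\<in>B. mdist W a b) \<le> mdist W a b0"
      by (rule cINF_lower[OF _ ab(2)]) (auto intro: bdd_belowI[of _ 0])
    also have "\<dots> \<le> mdist W a a0 + mdist W a0 b0"
      using that ab assms by (intro mdist_triangle) auto
    finally show ?thesis using K that ab(1) by force
  qed
  then show ?thesis by (rule bdd_aboveI2)
qed auto

lemma hausdorff_dist_lessD:
  assumes "A \<subseteq> mspace W" "B \<subseteq> mspace W" "A \<noteq> {}" "B \<noteq> {}"
    and KA: "\<forall>a\<in>A. \<forall>a'\<in>A. mdist W a a' \<le> K"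
    and KB: "\<forall>b\<in>B. \<forall>b'\<in>B. mdist W b b' \<le> L"
    and r: "hausdorff_dist W A B < r"
  shows "\<And>a. a \<in> A \<Longrightarrow> \<exists>b\<in>B. mdist W a b < r"
    and "\<And>b. b \<in> B \<Longrightarrow> \<exists>a\<in>A. mdist W a b < r"
    and "r > 0"
proof -
  have *: "\<exists>b\<in>B. mdist W a b < r"
    if "A \<subseteq> mspace W" "B \<subseteq> mspace W" "B \<noteq> {}"
     "\<forall>a\<in>A. \<forall>a'\<in>A. mdist W a a' \<le> K"
     "(SUP a\<in>A. INF b\<in>B. mdist W a b) < r" "a \<in> A" for A B K a
  proof -
    have "(INF b\<in>B. mdist W a b) \<le> (SUP a\<in>A. INF b\<in>B. mdist W a b)"
      by (rule cSUP_upper[OF that(6) hausdorff_dist_bdd[OF that(1-4)]])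
    moreover have "bdd_below (mdist W a ` B)" by (rule bdd_belowI[of _ 0]) auto
    ultimately show ?thesis using that cINF_less_iff[of B "mdist W a" r] by auto
  qed
  show 1: "\<exists>b\<in>B. mdist W a b < r" if "a \<in> A" for a
    by (rule *[OF assms(1,2,4) KA _ that]) (use r in \<open>auto simp: hausdorff_dist_def\<close>)
  show "\<exists>a\<in>A. mdist W a b < r" if "b \<in> B" for b
    using *[OF assms(2,1,3) KB _ that] r by (auto simp: hausdorff_dist_def mdist_commute)
  show "r > 0" using 1 \<open>A \<noteq> {}\<close> by (meson all_not_in_conv le_less_trans mdist_nonneg)
qed

lemma gh_realizable_imp_correspondence:
  fixes X :: "'a metric" and Y :: "'b metric" and W :: "'w metric"
  assumes "compact_metric X" "compact_metric Y" "gh_realizable W X Y s" "s < r"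
  shows "r > 0 \<and> (\<exists>R. correspondence X Y (2 * r) R)"
proof -
  obtain A B where AB: "A \<subseteq> mspace W" "B \<subseteq> mspace W" "hausdorff_dist W A B \<le> s"
    and iso: "isometric (submetric W A) X" "isometric (submetric W B) Y"
    using assms unfolding gh_realizable_def by blast
  have cA: "compact_metric (submetric W A)" and cB: "compact_metric (submetric W B)"
    using iso assms isometric_sym isometric_compact_metric by metis+
  obtain f where f: "bij_betw f A (mspace X)" "\<And>x x'. x \<in> A \<Longrightarrow> x' \<in> A \<Longrightarrow> mdist X (f x) (f x') = mdist W x x'"
    using iso(1) AB unfolding isometric_def by (auto simp: Int_absorb2)
  obtain g where g: "bij_betw g B (mspace Y)" "\<And>x x'. x \<in> B \<Longrightarrow> x' \<in> B \<Longrightarrow> mdist Y (g x) (g x') = mdist W x x'"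
    using iso(2) AB unfolding isometric_def by (auto simp: Int_absorb2)
  obtain K where K: "\<forall>a\<in>A. \<forall>a'\<in>A. mdist W a a' \<le> K"
    using compact_metric_bounded[OF cA] AB by (metis Int_absorb2 mspace_submetric mdist_submetric)
  obtain L where L: "\<forall>a\<in>B. \<forall>a'\<in>B. mdist W a a' \<le> L"
    using compact_metric_bounded[OF cB] AB by (metis Int_absorb2 mspace_submetric mdist_submetric)
  have ne: "A \<noteq> {}" "B \<noteq> {}" using cA cB by (auto simp: compact_metric_def)
  have hr: "hausdorff_dist W A B < r" using AB assms by simp
  have H: "\<And>a. a \<in> A \<Longrightarrow> \<exists>b\<in>B. mdist W a b < r" "\<And>b. b \<in> B \<Longrightarrow> \<exists>a\<in>A. mdist W a b < r" "r > 0"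
    using hausdorff_dist_lessD[OF AB(1,2) ne K L hr] by blast+
  define R where "R = (\<lambda>(a, b). (f a, g b)) ` {(a, b). a \<in> A \<and> b \<in> B \<and> mdist W a b < r}"
  have R0: "R \<subseteq> mspace X \<times> mspace Y"
    using f(1) g(1) by (auto simp: R_def bij_betw_def)
  have "fst ` R = mspace X"
  proof
    show "fst ` R \<subseteq> mspace X" using R0 by auto
    show "mspace X \<subseteq> fst ` R"
    proof
      fix x assume "x \<in> mspace X"
      then obtain a where a: "a \<in> A" "x = f a" using f(1) by (auto simp: bij_betw_def)
      then obtain b where "b \<in> B" "mdist W a b < r" using H(1) by blast
      then have "(f a, g b) \<in> R" using a by (auto simp: R_def)
      then show "x \<in> fst ` R" using a by force
    qed
  qed
  moreover have "snd ` R = mspace Y"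
  proof
    show "snd ` R \<subseteq> mspace Y" using R0 by auto
    show "mspace Y \<subseteq> snd ` R"
    proof
      fix y assume "y \<in> mspace Y"
      then obtain b where b: "b \<in> B" "y = g b" using g(1) by (auto simp: bij_betw_def)
      then obtain a where "a \<in> A" "mdist W a b < r" using H(2) by blast
      then have "(f a, g b) \<in> R" using b by (auto simp: R_def)
      then show "y \<in> snd ` R" using b by force
    qed
  qed
  moreover have "\<bar>mdist X (f a) (f a') - mdist Y (g b) (g b')\<bar> \<le> 2 * r"
    if "a \<in> A" "b \<in> B" "mdist W a b < r" "a' \<in> A" "b' \<in> B" "mdist W a' b' < r" for a b a' b'
  proof -
    have "a \<in> mspace W" "b \<in> mspace W" "a' \<in> mspace W" "b' \<in> mspace W" using that AB by auto
    then have "mdist W a a' \<le> mdist W a b + (mdist W b b' + mdist W a' b')"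
      "mdist W b b' \<le> mdist W a b + (mdist W a a' + mdist W a' b')"
      by (smt (verit) mdist_triangle mdist_commute)+
    then show ?thesis using that f(2) g(2) by auto
  qed
  ultimately have "correspondence X Y (2 * r) R"
    using R0 unfolding correspondence_def by (auto simp: R_def)
  then show ?thesis using H(3) by blast
qed

lemma correspondence_imp_gh_realizable:
  fixes X :: "'a metric" and Y :: "'b metric"
  assumes "compact_metric X" "compact_metric Y" "correspondence X Y (2 * r) R" "r > 0"
  shows "\<exists>W :: ('a + 'b) metric. gh_realizable W X Y r"
proof -
  let ?f = "\<lambda>x y p. mdist X x (fst p) + r + mdist Y (snd p) y"
  define c where "c x y = (INF p\<in>R. ?f x y p)" for x y
  define d where "d u v = (case u of Inl x \<Rightarrow> (case v of Inl x' \<Rightarrow> mdist X x x' | Inr y \<Rightarrow> c x y)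
      | Inr y \<Rightarrow> (case v of Inl x \<Rightarrow> c x y | Inr y' \<Rightarrow> mdist Y y y'))" for u v
  have R: "R \<subseteq> mspace X \<times> mspace Y" "fst ` R = mspace X" "snd ` R = mspace Y"
    and dis: "\<And>p q. \<lbrakk>p \<in> R; q \<in> R\<rbrakk> \<Longrightarrow>
       \<bar>mdist X (fst p) (fst q) - mdist Y (snd p) (snd q)\<bar> \<le> 2 * r"
    using assms(3) unfolding correspondence_def by auto
  have Rne: "R \<noteq> {}" using R assms(1) by (auto simp: compact_metric_def)
  have m: "fst p \<in> mspace X" "snd p \<in> mspace Y" if "p \<in> R" for p using R that by auto
  have cle: "c x y \<le> ?f x y p" if "p \<in> R" for x y p
    unfolding c_def
    by (rule cINF_lower[OF _ that]) (use \<open>r > 0\<close> in \<open>auto intro!: bdd_belowI[of _ 0]\<close>)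
  have cge: "c x y \<ge> b" if "\<And>p. p \<in> R \<Longrightarrow> b \<le> ?f x y p" for x y b
    unfolding c_def by (rule cINF_greatest[OF Rne]) (use that in auto)
  have cr: "c x y \<ge> r" for x y
    by (rule cge) (smt (verit) mdist_nonneg)
  have t1: "c x y \<le> mdist X x x' + c x' y"
    if "x \<in> mspace X" "x' \<in> mspace X" for x x' y
  proof -
    have "c x y - mdist X x x' \<le> c x' y"
    proof (rule cge)
      fix p assume "p \<in> R"
      then show "c x y - mdist X x x' \<le> ?f x' y p"
        using cle[of p x y] mdist_triangle[of x X x' "fst p"] m[of p] that by linarith
    qed
    then show ?thesis by simp
  qed
  have t2: "c x y \<le> c x y' + mdist Y y' y"
    if "y \<in> mspace Y" "y' \<in> mspace Y" for x y y'
  proof -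
    have "c x y - mdist Y y' y \<le> c x y'"
    proof (rule cge)
      fix p assume "p \<in> R"
      then show "c x y - mdist Y y' y \<le> ?f x y' p"
        using cle[of p x y] mdist_triangle[of "snd p" Y y' y] m[of p] that by linarith
    qed
    then show ?thesis by simp
  qed
  have t3: "mdist X x x' \<le> c x y + c x' y"
    if "x \<in> mspace X" "x' \<in> mspace X" "y \<in> mspace Y" for x x' y
  proof -
    have "mdist X x x' - c x' y \<le> c x y"
    proof (rule cge)
      fix p assume p: "p \<in> R"
      have "mdist X x x' - ?f x y p \<le> c x' y"
      proof (rule cge)
        fix q assume q: "q \<in> R"
        note pq = m[OF p] m[OF q]
        have "mdist X x x' \<le> mdist X x (fst p) + (mdist X (fst p) (fst q) + mdist X (fst q) x')"
          using mdist_triangle[OF that(1) pq(1) that(2)] mdist_triangle[OF pq(1) pq(3) that(2)]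
          by linarith
        moreover have "mdist Y (snd p) (snd q) \<le> mdist Y (snd p) y + mdist Y y (snd q)"
          by (rule mdist_triangle[OF pq(2) that(3) pq(4)])
        ultimately show "mdist X x x' - ?f x y p \<le> ?f x' y q"
          using dis[OF p q] by (simp add: mdist_commute[of X "fst q" x'] mdist_commute[of Y y "snd q"])
      qed
      then show "mdist X x x' - c x' y \<le> ?f x y p" by linarith
    qed
    then show ?thesis by simp
  qed
  have t4: "mdist Y y y' \<le> c x y + c x y'"
    if "y \<in> mspace Y" "y' \<in> mspace Y" "x \<in> mspace X" for y y' x
  proof -
    have "mdist Y y y' - c x y' \<le> c x y"
    proof (rule cge)
      fix p assume p: "p \<in> R"
      have "mdist Y y y' - ?f x y p \<le> c x y'"
      proof (rule cge)
        fix q assume q: "q \<in> R"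
        note pq = m[OF p] m[OF q]
        have "mdist Y y y' \<le> mdist Y y (snd p) + (mdist Y (snd p) (snd q) + mdist Y (snd q) y')"
          using mdist_triangle[OF that(1) pq(2) that(2)] mdist_triangle[OF pq(2) pq(4) that(2)]
          by linarith
        moreover have "mdist X (fst p) (fst q) \<le> mdist X (fst p) x + mdist X x (fst q)"
          by (rule mdist_triangle[OF pq(1) that(3) pq(3)])
        ultimately show "mdist Y y y' - ?f x y p \<le> ?f x y' q"
          using dis[OF p q] by (simp add: mdist_commute[of Y y "snd p"] mdist_commute[of X "fst p" x])
      qed
      then show "mdist Y y y' - c x y' \<le> ?f x y p" by linarith
    qed
    then show ?thesis by simp
  qed
  have c0: "c x y > 0" for x y using cr[of x y] \<open>r > 0\<close> by linarith
  interpret W: Metric_space "mspace X <+> mspace Y" d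
  proof
    show "0 \<le> d u v" for u v
      using c0 by (auto simp: d_def less_imp_le split: sum.split)
    show "d u v = d v u" for u v
      by (auto simp: d_def mdist_commute split: sum.split)
    show "d u v = 0 \<longleftrightarrow> u = v" if "u \<in> mspace X <+> mspace Y" "v \<in> mspace X <+> mspace Y" for u v
    proof -
      have "c x y \<noteq> 0" for x y using c0[of x y] by simp
      then show ?thesis using that by (auto simp: d_def)
    qed
    show "d u w \<le> d u v + d v w"
      if "u \<in> mspace X <+> mspace Y" "v \<in> mspace X <+> mspace Y" "w \<in> mspace X <+> mspace Y" for u v w
    proof -
      have t1': "c x y \<le> c x' y + mdist X x' x" if "x \<in> mspace X" "x' \<in> mspace X" for x x' y
        using t1[OF that, of y] by (simp add: mdist_commute[of X x x'])
      have t2': "c x y \<le> mdist Y y y' + c x y'" if "y \<in> mspace Y" "y' \<in> mspace Y" for x y y'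
        using t2[OF that, of x] by (simp add: mdist_commute[of Y y' y])
      show ?thesis
        using that unfolding d_def
        by (elim PlusE; clarify;
            simp only: sum.case mdist_triangle t1 t2 t3 t4 t1' t2')
    qed
  qed
  let ?W = "metric (mspace X <+> mspace Y, d)"
  let ?A = "Inl ` mspace X :: ('a + 'b) set" and ?B = "Inr ` mspace Y :: ('a + 'b) set"
  have AB: "?A \<subseteq> mspace ?W" "?B \<subseteq> mspace ?W" by auto
  have "isometric X (submetric ?W ?A)"
    unfolding isometric_def
    by (rule exI[of _ Inl]) (auto simp: bij_betw_def d_def)
  moreover have "isometric Y (submetric ?W ?B)"
    unfolding isometric_def
    by (rule exI[of _ Inr]) (auto simp: bij_betw_def d_def)
  moreover have "hausdorff_dist ?W ?A ?B \<le> r"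
  proof -
    have cR: "c x y \<le> r" if "(x, y) \<in> R" for x y
    proof -
      have "mdist X x x = 0" "mdist Y y y = 0" using m[OF that] by simp_all
      then show ?thesis using cle[OF that, of x y] unfolding fst_conv snd_conv by linarith
    qed
    have "(SUP a\<in>?A. INF b\<in>?B. d a b) \<le> r"
    proof (rule cSUP_least)
      show "?A \<noteq> {}" using assms(1) by (auto simp: compact_metric_def)
      fix a assume "a \<in> ?A"
      then obtain x y where xy: "a = Inl x" "(x, y) \<in> R" using R(2) by force
      have "(INF b\<in>?B. d a b) \<le> d a (Inr y)"
        by (rule cINF_lower) (use m[OF xy(2)] in \<open>auto intro: bdd_belowI[of _ 0]\<close>)
      then show "(INF b\<in>?B. d a b) \<le> r" using cR[OF xy(2)] by (simp add: xy d_def)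
    qed
    moreover have "(SUP b\<in>?B. INF a\<in>?A. d a b) \<le> r"
    proof (rule cSUP_least)
      show "?B \<noteq> {}" using assms(2) by (auto simp: compact_metric_def)
      fix b assume "b \<in> ?B"
      then obtain x y where xy: "b = Inr y" "(x, y) \<in> R" using R(3) by force
      have "(INF a\<in>?A. d a b) \<le> d (Inl x) b"
        by (rule cINF_lower) (use m[OF xy(2)] in \<open>auto intro: bdd_belowI[of _ 0]\<close>)
      then show "(INF a\<in>?A. d a b) \<le> r" using cR[OF xy(2)] by (simp add: xy d_def)
    qed
    ultimately show ?thesis by (simp add: hausdorff_dist_def)
  qed
  ultimately have "gh_realizable ?W X Y r"
    unfolding gh_realizable_def
    by (intro exI[of _ ?A] exI[of _ ?B] conjI AB) (auto intro: isometric_sym simp del: mspace_submetric)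
  then show ?thesis by (rule exI)
qed

lemma correspondence_mono: "\<lbrakk>correspondence X Y e R; e \<le> e'\<rbrakk> \<Longrightarrow> correspondence X Y e' R"
  unfolding correspondence_def by (meson order_trans)

lemma correspondence_full:
  assumes "compact_metric X" "compact_metric Y"
  obtains r where "r > 0" "correspondence X Y (2 * r) (mspace X \<times> mspace Y)"
proof -
  obtain K where K: "K > 0" "\<forall>x\<in>mspace X. \<forall>x'\<in>mspace X. mdist X x x' \<le> K"
    using compact_metric_bounded[OF assms(1)] by blast
  obtain L where L: "L > 0" "\<forall>x\<in>mspace Y. \<forall>x'\<in>mspace Y. mdist Y x x' \<le> L"
    using compact_metric_bounded[OF assms(2)] by blast
  have "\<bar>mdist X x x' - mdist Y y y'\<bar> \<le> 2 * (K + L)"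
    if "x \<in> mspace X" "x' \<in> mspace X" "y \<in> mspace Y" "y' \<in> mspace Y" for x x' y y'
  proof -
    have "mdist X x x' \<le> K" "mdist Y y y' \<le> L" using K L that by blast+
    moreover have "0 \<le> mdist X x x'" "0 \<le> mdist Y y y'" by simp_all
    ultimately have "mdist X x x' - mdist Y y y' \<le> 2 * (K + L)"
      "- (mdist X x x' - mdist Y y y') \<le> 2 * (K + L)"
      using K(1) L(1) unfolding distrib_left by linarith+
    then show ?thesis by (rule abs_leI)
  qed
  then have "correspondence X Y (2 * (K + L)) (mspace X \<times> mspace Y)"
    using assms unfolding correspondence_def compact_metric_def by auto
  then show ?thesis using that[of "K + L"] K L by simp
qed

lemma gh_distance_less_iff:
  fixes X :: "'a metric" and Y :: "'b metric"
  assumes "compact_metric X" "compact_metric Y"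
  shows "gh_distance X Y < e \<longleftrightarrow> (\<exists>r R. 0 < r \<and> r < e \<and> correspondence X Y (2 * r) R)"
proof -
  let ?S = "{r. \<exists>W :: ('a + 'b) metric. gh_realizable W X Y r}"
  have ne: "?S \<noteq> {}"
  proof -
    obtain r where "r > 0" "correspondence X Y (2 * r) (mspace X \<times> mspace Y)"
      by (rule correspondence_full[OF assms])
    then show ?thesis using correspondence_imp_gh_realizable[OF assms] by blast
  qed
  have "0 \<le> r" if "r \<in> ?S" for r
  proof (rule dense_ge)
    fix t assume "r < t"
    then show "0 \<le> t" using that gh_realizable_imp_correspondence[OF assms, of _ r t]
      by (blast intro: less_imp_le)
  qed
  then have bdd: "bdd_below ?S" by (rule bdd_belowI)
  show ?thesis
  proof
    assume "gh_distance X Y < e"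
    then obtain s where "s \<in> ?S" "s < e"
      unfolding gh_distance_def using cInf_less_iff[OF ne bdd] by blast
    moreover obtain r where "s < r" "r < e" using \<open>s < e\<close> dense by blast
    ultimately show "\<exists>r R. 0 < r \<and> r < e \<and> correspondence X Y (2 * r) R"
      using gh_realizable_imp_correspondence[OF assms] by blast
  next
    assume "\<exists>r R. 0 < r \<and> r < e \<and> correspondence X Y (2 * r) R"
    then obtain r R where r: "0 < r" "r < e" "correspondence X Y (2 * r) R" by blast
    then have "r \<in> ?S" using correspondence_imp_gh_realizable[OF assms] by blast
    then have "gh_distance X Y \<le> r" unfolding gh_distance_def by (rule cInf_lower[OF _ bdd])
    then show "gh_distance X Y < e" using r by simp
  qed
qed

lemma gh_distance_nonneg:
  assumes "compact_metric X" "compact_metric Y" shows "gh_distance X Y \<ge> 0"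
  using gh_distance_less_iff[OF assms, of 0] by force

lemma correspondence_converse:
  "correspondence X Y e R \<Longrightarrow> correspondence Y X e (R\<inverse>)"
  unfolding correspondence_def fst_eq_Domain snd_eq_Range Domain_converse Range_converse
  by (auto simp: abs_minus_commute)

lemma gh_distance_commute:
  assumes "compact_metric X" "compact_metric Y" shows "gh_distance X Y = gh_distance Y X"
proof -
  have *: "gh_distance X Y < e \<longleftrightarrow> gh_distance Y X < e" for e
    unfolding gh_distance_less_iff[OF assms] gh_distance_less_iff[OF assms(2,1)]
    by (meson correspondence_converse)
  show ?thesis
    using *[of "gh_distance X Y"] *[of "gh_distance Y X"] by linarith
qed

lemma correspondence_relcomp:
  assumes "correspondence X Y e R" "correspondence Y Z e' R'"
  shows "correspondence X Z (e + e') (R O R')"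
proof -
  have R: "R \<subseteq> mspace X \<times> mspace Y" "fst ` R = mspace X" "snd ` R = mspace Y"
    and dis: "\<And>x y x' y'. \<lbrakk>(x, y) \<in> R; (x', y') \<in> R\<rbrakk> \<Longrightarrow> \<bar>mdist X x x' - mdist Y y y'\<bar> \<le> e"
    using assms(1) unfolding correspondence_def by auto
  have R': "R' \<subseteq> mspace Y \<times> mspace Z" "fst ` R' = mspace Y" "snd ` R' = mspace Z"
    and dis': "\<And>x y x' y'. \<lbrakk>(x, y) \<in> R'; (x', y') \<in> R'\<rbrakk> \<Longrightarrow> \<bar>mdist Y x x' - mdist Z y y'\<bar> \<le> e'"
    using assms(2) unfolding correspondence_def by auto
  have sub: "R O R' \<subseteq> mspace X \<times> mspace Z" using R R' by auto
  have "x \<in> fst ` (R O R')" if x: "x \<in> mspace X" for x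
  proof -
    obtain y where y: "(x, y) \<in> R" using x R(2) by force
    then have "y \<in> fst ` R'" using R R' by auto
    then obtain z where "(y, z) \<in> R'" by force
    with y have "(x, z) \<in> R O R'" by blast
    then show ?thesis by force
  qed
  then have fst: "fst ` (R O R') = mspace X" using sub by auto
  have "z \<in> snd ` (R O R')" if z: "z \<in> mspace Z" for z
  proof -
    obtain y where y: "(y, z) \<in> R'" using z R'(3) by force
    then have "y \<in> snd ` R" using R R' by auto
    then obtain x where "(x, y) \<in> R" by force
    with y have "(x, z) \<in> R O R'" by blast
    then show ?thesis by force
  qed
  then have snd: "snd ` (R O R') = mspace Z" using sub by auto
  have "\<bar>mdist X x x' - mdist Z z z'\<bar> \<le> e + e'"
    if "(x, z) \<in> R O R'" "(x', z') \<in> R O R'" for x x' z z'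
  proof -
    obtain y y' where "(x, y) \<in> R" "(y, z) \<in> R'" "(x', y') \<in> R" "(y', z') \<in> R'"
      using \<open>(x, z) \<in> R O R'\<close> \<open>(x', z') \<in> R O R'\<close> by blast
    then have "\<bar>mdist X x x' - mdist Y y y'\<bar> \<le> e" "\<bar>mdist Y y y' - mdist Z z z'\<bar> \<le> e'"
      using dis dis' by blast+
    then show ?thesis by linarith
  qed
  then show ?thesis unfolding correspondence_def by (intro conjI sub fst snd allI impI)
qed

lemma gh_distance_triangle:
  assumes "compact_metric X" "compact_metric Y" "compact_metric Z"
  shows "gh_distance X Z \<le> gh_distance X Y + gh_distance Y Z"
proof (rule field_le_epsilon)
  fix e :: real assume "e > 0"
  then have "gh_distance X Y < gh_distance X Y + e / 2" "gh_distance Y Z < gh_distance Y Z + e / 2"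
    by auto
  then obtain r R s S where r: "0 < r" "r < gh_distance X Y + e / 2" "correspondence X Y (2 * r) R"
    and s: "0 < s" "s < gh_distance Y Z + e / 2" "correspondence Y Z (2 * s) S"
    unfolding gh_distance_less_iff[OF assms(1,2)] gh_distance_less_iff[OF assms(2,3)] by blast
  have "correspondence X Z (2 * (r + s)) (R O S)"
    using correspondence_relcomp[OF r(3) s(3)] by (simp add: algebra_simps)
  then have "gh_distance X Z < gh_distance X Y + gh_distance Y Z + e"
    unfolding gh_distance_less_iff[OF assms(1,3)]
    using r s by (intro exI[of _ "r + s"] exI[of _ "R O S"]) auto
  then show "gh_distance X Z \<le> gh_distance X Y + gh_distance Y Z + e" by simp
qed


subsection \<open>Compact metric spaces at distance zero are isometric\<close>

lemma almost_isometries_imp_isometry: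
  fixes X :: "'a metric" and Y :: "'b metric"
  assumes Y: "compact_metric Y"
    and ex: "\<And>e. e > 0 \<Longrightarrow> \<exists>f. f ` mspace X \<subseteq> mspace Y \<and>
       (\<forall>x\<in>mspace X. \<forall>x'\<in>mspace X. \<bar>mdist Y (f x) (f x') - mdist X x x'\<bar> \<le> e)"
  obtains f where "f ` mspace X \<subseteq> mspace Y"
    "\<And>x x'. \<lbrakk>x \<in> mspace X; x' \<in> mspace X\<rbrakk> \<Longrightarrow> mdist Y (f x) (f x') = mdist X x x'"
proof -
  let ?P = "product_topology (\<lambda>_. mtopology_of Y) (mspace X)"
  define C where "C e = {F \<in> mspace X \<rightarrow>\<^sub>E mspace Y.
      \<forall>x\<in>mspace X. \<forall>x'\<in>mspace X. \<bar>mdist Y (F x) (F x') - mdist X x x'\<bar> \<le> e}" for e :: real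
  have top: "topspace ?P = mspace X \<rightarrow>\<^sub>E mspace Y" by simp
  have "compact_space ?P" using Y by (simp add: compact_space_product_topology compact_metric_def)
  moreover have "closedin ?P (C e)" for e
  proof -
    have cl: "closedin ?P {F \<in> topspace ?P. mdist Y (F x) (F x') \<in> {mdist X x x' - e .. mdist X x x' + e}}"
      if "x \<in> mspace X" "x' \<in> mspace X" for x x'
    proof (rule closedin_continuous_map_preimage)
      show "continuous_map ?P euclideanreal (\<lambda>F. mdist Y (F x) (F x'))"
        by (intro continuous_map_mdist continuous_map_product_projection that)
    qed simp
    have "C e = topspace ?P \<inter> (\<Inter>p\<in>mspace X \<times> mspace X.
      {F \<in> topspace ?P. mdist Y (F (fst p)) (F (snd p)) \<in>
         {mdist X (fst p) (snd p) - e .. mdist X (fst p) (snd p) + e}})"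
      unfolding C_def top by (auto simp: abs_le_iff) (smt (verit))+
    also have "closedin ?P \<dots>"
    proof (cases "mspace X = {}")
      case True
      then show ?thesis using closedin_topspace[of ?P] by simp
    next
      case False
      then show ?thesis by (intro closedin_Int closedin_INT closedin_topspace cl) auto
    qed
    finally show ?thesis .
  qed
  moreover have "\<forall>\<F>. finite \<F> \<and> \<F> \<subseteq> C ` {0<..} \<longrightarrow> \<Inter>\<F> \<noteq> {}"
  proof (intro allI impI; elim conjE)
    fix \<F> assume fin: "finite \<F>" and sub: "\<F> \<subseteq> C ` {0<..}"
    obtain E where E: "finite E" "E \<subseteq> {0<..}" "\<F> = C ` E"
      using finite_subset_image[OF fin sub] by blast
    define e where "e = Min (insert 1 E)"
    have e: "e > 0" "\<And>e'. e' \<in> E \<Longrightarrow> e \<le> e'" using E by (auto simp: e_def)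
    obtain f where f: "f ` mspace X \<subseteq> mspace Y"
      "\<And>x x'. x \<in> mspace X \<Longrightarrow> x' \<in> mspace X \<Longrightarrow> \<bar>mdist Y (f x) (f x') - mdist X x x'\<bar> \<le> e"
      using ex[OF e(1)] by blast
    have "restrict f (mspace X) \<in> C e'" if "e' \<in> E" for e'
    proof -
      have "\<bar>mdist Y (f x) (f x') - mdist X x x'\<bar> \<le> e'" if "x \<in> mspace X" "x' \<in> mspace X" for x x'
        using f(2)[OF that] e(2)[OF \<open>e' \<in> E\<close>] by (rule order_trans)
      then show ?thesis using f(1) by (auto simp: C_def)
    qed
    then show "\<Inter>\<F> \<noteq> {}" using E(3) by auto
  qed
  ultimately have "\<Inter>(C ` {0<..}) \<noteq> {}"
    unfolding compact_space_fip by simp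
  then obtain F where F: "\<And>e. e > 0 \<Longrightarrow> F \<in> C e" by blast
  show thesis
  proof (rule that[of F])
    show "F ` mspace X \<subseteq> mspace Y" using F[of 1] by (auto simp: C_def)
    fix x x' assume "x \<in> mspace X" "x' \<in> mspace X"
    then have "\<bar>mdist Y (F x) (F x') - mdist X x x'\<bar> \<le> 0 + e" if "e > 0" for e
      using F[OF that] by (auto simp: C_def)
    then have "\<bar>mdist Y (F x) (F x') - mdist X x x'\<bar> \<le> 0" by (rule field_le_epsilon)
    then show "mdist Y (F x) (F x') = mdist X x x'" by simp
  qed
qed

lemma compact_metric_self_isometry_surj:
  assumes X: "compact_metric X" and h: "h ` mspace X \<subseteq> mspace X"
    and d: "\<And>x x'. \<lbrakk>x \<in> mspace X; x' \<in> mspace X\<rbrakk> \<Longrightarrow> mdist X (h x) (h x') = mdist X x x'"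
  shows "h ` mspace X = mspace X"
proof (rule ccontr)
  interpret X: Metric_space "mspace X" "mdist X" by simp
  assume "h ` mspace X \<noteq> mspace X"
  then obtain x where x: "x \<in> mspace X" "x \<notin> h ` mspace X" using h by blast
  have cpt: "compactin X.mtopology (mspace X)"
    using X by (simp add: compact_metric_def compact_space_def mtopology_of_def)
  interpret H: Metric_space12 "mspace X" "mdist X" "mspace X" "mdist X" by unfold_locales
  have "embedding_map X.mtopology X.mtopology h"
    by (rule H.isometry_imp_embedding_map) (use h d in auto)
  then have "continuous_map X.mtopology X.mtopology h"
    unfolding embedding_map_def
    using homeomorphic_imp_continuous_map continuous_map_in_subtopology by blast
  then have "compactin X.mtopology (h ` mspace X)" using cpt image_compactin by blast
  then have "closedin X.mtopology (h ` mspace X)"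
    using X.Hausdorff_space_mtopology compactin_imp_closedin by blast
  then obtain e where e: "e > 0" "X.mball x e \<inter> h ` mspace X = {}"
  proof -
    have "x \<in> mspace X - h ` mspace X" using x by simp
    with \<open>closedin X.mtopology (h ` mspace X)\<close> show thesis
      using that unfolding X.closedin_metric by (metis disjnt_def Int_commute)
  qed
  have e': "mdist X x (h y) \<ge> e" if "y \<in> mspace X" for y
    using e that x h by (force simp: X.mball_def)
  have hm: "(h ^^ n) y \<in> mspace X" if "y \<in> mspace X" for n y
    using that h by (induction n) auto
  have hd: "mdist X ((h ^^ n) y) ((h ^^ n) z) = mdist X y z" if "y \<in> mspace X" "z \<in> mspace X" for n y z
    using that hm d by (induction n) auto
  have sep: "mdist X ((h ^^ m) x) ((h ^^ n) x) \<ge> e" if "m < n" for m n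
  proof -
    obtain k where k: "n = m + Suc k" using \<open>m < n\<close> less_imp_Suc_add by auto
    have "mdist X ((h ^^ m) x) ((h ^^ n) x) = mdist X x ((h ^^ Suc k) x)"
      unfolding k funpow_add comp_apply using x hm[of x "Suc k"] by (intro hd) auto
    also have "\<dots> \<ge> e" using e'[of "(h ^^ k) x"] hm x by simp
    finally show ?thesis .
  qed
  obtain l \<phi> where l: "strict_mono (\<phi> :: nat \<Rightarrow> nat)"
    and lim: "limitin X.mtopology ((\<lambda>n. (h ^^ n) x) \<circ> \<phi>) l sequentially"
    using cpt hm[OF x(1)] unfolding X.compactin_sequentially by (metis image_subset_iff)
  have "\<forall>\<^sub>F n in sequentially. mdist X ((h ^^ \<phi> n) x) l < e / 2"
  proof -
    have "\<forall>\<^sub>F n in sequentially. (h ^^ \<phi> n) x \<in> mspace X \<and> mdist X ((h ^^ \<phi> n) x) l < e / 2"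
      using lim half_gt_zero[OF e(1)] unfolding X.limitin_metric comp_apply by blast
    then show ?thesis by (rule eventually_mono) simp
  qed
  then obtain N where N: "\<And>n. n \<ge> N \<Longrightarrow> mdist X ((h ^^ \<phi> n) x) l < e / 2"
    unfolding eventually_sequentially by blast
  have "l \<in> mspace X" using lim X.limitin_mspace by blast
  then have "mdist X ((h ^^ \<phi> N) x) ((h ^^ \<phi> (Suc N)) x) < e"
    using mdist_triangle[of "(h ^^ \<phi> N) x" X l "(h ^^ \<phi> (Suc N)) x"] hm x N[of N] N[of "Suc N"]
    by (simp add: mdist_commute[of X l])
  moreover have "\<phi> N < \<phi> (Suc N)" using l by (simp add: strict_mono_Suc_iff)
  ultimately show False using sep[of "\<phi> N" "\<phi> (Suc N)"] by linarith
qed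

lemma gh_distance_0_imp_embedding:
  assumes "compact_metric X" "compact_metric Y" "gh_distance X Y = 0"
  obtains f where "f ` mspace X \<subseteq> mspace Y"
    "\<And>x x'. \<lbrakk>x \<in> mspace X; x' \<in> mspace X\<rbrakk> \<Longrightarrow> mdist Y (f x) (f x') = mdist X x x'"
proof -
  have "\<exists>f. f ` mspace X \<subseteq> mspace Y \<and>
       (\<forall>x\<in>mspace X. \<forall>x'\<in>mspace X. \<bar>mdist Y (f x) (f x') - mdist X x x'\<bar> \<le> e)" if "e > 0" for e
  proof -
    have "gh_distance X Y < e / 2" using assms(3) \<open>e > 0\<close> by simp
    then obtain r R where r: "0 < r" "r < e / 2" "correspondence X Y (2 * r) R"
      unfolding gh_distance_less_iff[OF assms(1,2)] by blast
    have "correspondence X Y e R" by (rule correspondence_mono[OF r(3)]) (use r in simp)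
    then have R: "R \<subseteq> mspace X \<times> mspace Y" "fst ` R = mspace X"
      and dis: "\<And>x y x' y'. \<lbrakk>(x, y) \<in> R; (x', y') \<in> R\<rbrakk> \<Longrightarrow> \<bar>mdist X x x' - mdist Y y y'\<bar> \<le> e"
      unfolding correspondence_def by auto
    have "\<forall>x\<in>mspace X. \<exists>y. (x, y) \<in> R" using R(2) by force
    then obtain f where f: "\<And>x. x \<in> mspace X \<Longrightarrow> (x, f x) \<in> R" by metis
    show ?thesis
      by (rule exI[of _ f]) (use f R dis in \<open>auto simp: abs_minus_commute\<close>)
  qed
  then show thesis using almost_isometries_imp_isometry[OF assms(2)] that by blast
qed

lemma gh_distance_eq_0_iff:
  fixes X :: "'a metric" and Y :: "'b metric"
  assumes "compact_metric X" "compact_metric Y"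
  shows "gh_distance X Y = 0 \<longleftrightarrow> isometric X Y"
proof
  assume 0: "gh_distance X Y = 0"
  obtain f where f: "f ` mspace X \<subseteq> mspace Y"
    "\<And>x x'. \<lbrakk>x \<in> mspace X; x' \<in> mspace X\<rbrakk> \<Longrightarrow> mdist Y (f x) (f x') = mdist X x x'"
    using gh_distance_0_imp_embedding[OF assms 0] by blast
  obtain g where g: "g ` mspace Y \<subseteq> mspace X"
    "\<And>x x'. \<lbrakk>x \<in> mspace Y; x' \<in> mspace Y\<rbrakk> \<Longrightarrow> mdist X (g x) (g x') = mdist Y x x'"
    using gh_distance_0_imp_embedding[OF assms(2,1)] 0 gh_distance_commute[OF assms] by metis
  have "(f \<circ> g) ` mspace Y = mspace Y"
    by (rule compact_metric_self_isometry_surj[OF assms(2)]) (use f g in \<open>auto simp: image_subset_iff\<close>)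
  then have "mspace Y = f ` (g ` mspace Y)" by (simp add: image_comp)
  then have "f ` mspace X = mspace Y" using f(1) g(1) by blast
  moreover have "inj_on f (mspace X)"
    using f(2) by (intro inj_onI) (metis calculation image_eqI mdist_zero)
  ultimately show "isometric X Y" unfolding isometric_def bij_betw_def using f(2) by blast
next
  assume "isometric X Y"
  then obtain h where h: "bij_betw h (mspace X) (mspace Y)"
    "\<And>x x'. \<lbrakk>x \<in> mspace X; x' \<in> mspace X\<rbrakk> \<Longrightarrow> mdist Y (h x) (h x') = mdist X x x'"
    unfolding isometric_def by blast
  have "correspondence X Y (2 * r) ((\<lambda>x. (x, h x)) ` mspace X)" if "r > 0" for r
    unfolding correspondence_def using h that by (auto simp: bij_betw_def image_image)
  then have "gh_distance X Y < e" if "e > 0" for e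
    unfolding gh_distance_less_iff[OF assms] using that dense[OF that] by blast
  then have "gh_distance X Y \<le> 0" by (meson not_less less_irrefl)
  then show "gh_distance X Y = 0" using gh_distance_nonneg[OF assms] by simp
qed


section \<open>The Gromov--Hausdorff space\<close>

text \<open>Isometry classes of non-empty compact metric spaces. By lemma
  \<open>compact_metric_isometric_real\<close> each of them has a representative on a set of real numbers.\<close>

quotient_type gh_space = "real metric" / partial:
  "\<lambda>X Y. compact_metric X \<and> compact_metric Y \<and> isometric X Y"
proof (rule part_equivpI)
  let ?X = "submetric euclidean_metric {0 :: real}"
  have "compact_metric ?X"
    by (simp add: compact_metric_def mtopology_of_submetric compact_space_subtopology)
  then show "\<exists>X :: real metric. compact_metric X \<and> compact_metric X \<and> isometric X X"
    using isometric_refl by blast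
next
  show "symp (\<lambda>X Y :: real metric. compact_metric X \<and> compact_metric Y \<and> isometric X Y)"
    by (rule sympI) (simp add: isometric_sym)
  show "transp (\<lambda>X Y :: real metric. compact_metric X \<and> compact_metric Y \<and> isometric X Y)"
    by (rule transpI) (meson isometric_trans)
qed

instantiation gh_space :: metric_space
begin

lift_definition dist_gh_space :: "gh_space \<Rightarrow> gh_space \<Rightarrow> real" is gh_distance
  using gh_distance_isometric by blast

definition uniformity_gh_space :: "(gh_space \<times> gh_space) filter" where
  "uniformity_gh_space = (INF e\<in>{0<..}. principal {(x, y). dist x y < e})"

definition open_gh_space :: "gh_space set \<Rightarrow> bool" where
  "open_gh_space U \<longleftrightarrow> (\<forall>x\<in>U. \<forall>\<^sub>F (x', y) in uniformity. x' = x \<longrightarrow> y \<in> U)"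

instance
proof
  show "dist x y = 0 \<longleftrightarrow> x = y" for x y :: gh_space
    by transfer (simp add: gh_distance_eq_0_iff)
  show "dist x y \<le> dist x z + dist y z" for x y z :: gh_space
  proof transfer
    fix X Y Z :: "real metric"
    assume "compact_metric X \<and> compact_metric X \<and> isometric X X"
      "compact_metric Y \<and> compact_metric Y \<and> isometric Y Y"
      "compact_metric Z \<and> compact_metric Z \<and> isometric Z Z"
    then show "gh_distance X Y \<le> gh_distance X Z + gh_distance Y Z"
      using gh_distance_triangle[of X Z Y] gh_distance_commute[of Y Z] by simp
  qed
qed (rule uniformity_gh_space_def open_gh_space_def)+

end

definition metric_segment :: "'a::metric_space \<Rightarrow> 'a \<Rightarrow> 'a set" where
  "metric_segment x y = {z. dist x z + dist z y = dist x y}"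

end

theory Submission
  imports Defs
begin

text \<open>
  A correspondence between \<open>X\<close> and \<open>Y\<close> of distortion at most \<open>2c\<close> witnesses \<open>d\<^sub>G\<^sub>H(X, Y) \<le> c\<close>, and
  compactness of \<open>X\<close> and \<open>Y\<close> yields a closed correspondence \<open>R\<close> that is optimal, that is, of
  distortion at most \<open>2c\<close> for \<open>c = d\<^sub>G\<^sub>H(X, Y)\<close> itself (\<open>optimal_correspondence_exists\<close>).
  With the average of the two metrics, \<open>R\<close> is a compact space, since it is closed in \<open>X \<times> Y\<close>. It is
  a midpoint of \<open>X\<close> and \<open>Y\<close>: the averaged metric differs from each of them
  by at most \<open>c\<close>, so each of the two distances is at most \<open>c / 2\<close>.

  This midpoint leaves room for noise. Replace every point of \<open>R\<close> by \<open>n + 1\<close> copies, and take the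
  distance between points with different copy numbers to be the maximum of the averaged distance
  and \<open>c\<close>. Raising a distance up to \<open>c\<close> cannot make it exceed a non-negative number by more than
  \<open>c\<close>, so the projections to \<open>X\<close> and \<open>Y\<close> still have distortion at most \<open>c\<close>
  (\<open>gh_distance_thick_midpoint_le\<close>). Hence each of these spaces lies in the segment \<open>[X, Y]\<close>.

  The \<open>n\<close>-th one contains \<open>n + 1\<close> points at mutual distance at least \<open>c > 0\<close>. In a compact set of
  spaces this is impossible for all \<open>n\<close>: the spaces close to a given compact space \<open>W\<close> have
  \<open>c\<close>-separated subsets of bounded size only (\<open>gh_distance_separated_bound\<close>), so the sequence
  cannot have a subsequence that converges to \<open>W\<close>.
\<close>

section \<open>Optimal correspondences\<close>

lemma gh_distance_le_correspondence:
  fixes X :: "'a metric" and Y :: "'b metric"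
  assumes "compact_metric X" "compact_metric Y" "correspondence X Y (2 * r) R" "r > 0"
  shows "gh_distance X Y \<le> r"
proof (rule dense_ge)
  fix e assume "r < e"
  then have "gh_distance X Y < e"
    unfolding gh_distance_less_iff[OF assms(1,2)] using assms(3,4) by blast
  then show "gh_distance X Y \<le> e" by simp
qed

lemma continuous_map_distortion:
  assumes "continuous_map T (prod_topology (mtopology_of X) (mtopology_of Y)) f"
    and "continuous_map T (prod_topology (mtopology_of X) (mtopology_of Y)) g"
  shows "continuous_map T euclideanreal
    (\<lambda>t. \<bar>mdist X (fst (f t)) (fst (g t)) - mdist Y (snd (f t)) (snd (g t))\<bar>)"
proof -
  have c: "continuous_map T (mtopology_of X) (\<lambda>t. fst (h t))"
    "continuous_map T (mtopology_of Y) (\<lambda>t. snd (h t))"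
    if "continuous_map T (prod_topology (mtopology_of X) (mtopology_of Y)) h" for h
    using continuous_map_compose[OF that continuous_map_fst]
      continuous_map_compose[OF that continuous_map_snd] by (simp_all add: o_def)
  show ?thesis
    by (intro continuous_map_real_abs continuous_map_diff continuous_map_mdist c assms)
qed

lemma closedin_distortion_le:
  assumes "continuous_map T (prod_topology (mtopology_of X) (mtopology_of Y)) f"
    and "continuous_map T (prod_topology (mtopology_of X) (mtopology_of Y)) g"
  shows "closedin T {t \<in> topspace T.
    \<bar>mdist X (fst (f t)) (fst (g t)) - mdist Y (snd (f t)) (snd (g t))\<bar> \<le> e}"
  using closedin_continuous_map_preimage[OF continuous_map_distortion[OF assms], of "{..e}"] by simp

text \<open>Distortion is a continuous function of two pairs, and the closure of \<open>R \<times> R\<close> is the square of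
  the closure of \<open>R\<close>; so a bound on it survives closing up.\<close>

lemma correspondence_closure_of:
  assumes "correspondence X Y e R"
  shows "correspondence X Y e (prod_topology (mtopology_of X) (mtopology_of Y) closure_of R)"
proof -
  let ?T = "prod_topology (mtopology_of X) (mtopology_of Y)"
  let ?C = "?T closure_of R"
  let ?D = "{t \<in> topspace (prod_topology ?T ?T).
    \<bar>mdist X (fst (fst t)) (fst (snd t)) - mdist Y (snd (fst t)) (snd (snd t))\<bar> \<le> e}"
  have R: "R \<subseteq> mspace X \<times> mspace Y" "fst ` R = mspace X" "snd ` R = mspace Y"
    and dis: "\<And>x y x' y'. \<lbrakk>(x, y) \<in> R; (x', y') \<in> R\<rbrakk> \<Longrightarrow> \<bar>mdist X x x' - mdist Y y y'\<bar> \<le> e"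
    using assms unfolding correspondence_def by auto
  have RC: "R \<subseteq> ?C" using R(1) by (intro closure_of_subset) simp
  have C: "?C \<subseteq> mspace X \<times> mspace Y" using closure_of_subset_topspace[of ?T R] by simp
  have "closedin (prod_topology ?T ?T) ?D"
    by (intro closedin_distortion_le continuous_map_fst continuous_map_snd)
  moreover have "R \<times> R \<subseteq> ?D" using R(1) dis by auto
  ultimately have "prod_topology ?T ?T closure_of (R \<times> R) \<subseteq> ?D" by (simp add: closure_of_minimal)
  then have "?C \<times> ?C \<subseteq> ?D" by (simp add: closure_of_Times)
  moreover have "fst ` ?C = mspace X" "snd ` ?C = mspace Y" using R RC C by force+
  ultimately show ?thesis using C unfolding correspondence_def by auto
qed

text \<open>A correspondence is encoded by a choice function on the disjoint union of \<open>X\<close> and \<open>Y\<close>, which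
  selects for each point a pair that has it as a coordinate. These functions form a compact space
  by Tychonoff's theorem, and those of distortion at most \<open>e\<close> form a closed subset \<open>C e\<close>, non-empty
  for \<open>e > 2 * gh_distance X Y\<close>. The range of a member of the intersection of these
  sets is an optimal correspondence, and so is its closure.\<close>

lemma optimal_correspondence_exists:
  fixes X :: "'a metric" and Y :: "'b metric"
  assumes X: "compact_metric X" and Y: "compact_metric Y"
  obtains R where "correspondence X Y (2 * gh_distance X Y) R"
    "closedin (prod_topology (mtopology_of X) (mtopology_of Y)) R"
proof -
  let ?T = "prod_topology (mtopology_of X) (mtopology_of Y)"
  let ?d = "gh_distance X Y"
  define I where "I = mspace X <+> mspace Y"
  define A :: "'a + 'b \<Rightarrow> ('a \<times> 'b) set"
    where "A = case_sum (\<lambda>x. {x} \<times> mspace Y) (\<lambda>y. mspace X \<times> {y})"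
  define P where "P = product_topology (\<lambda>u. subtopology ?T (A u)) I"
  define C where "C e = {F \<in> topspace P. \<forall>u\<in>I. \<forall>v\<in>I.
    \<bar>mdist X (fst (F u)) (fst (F v)) - mdist Y (snd (F u)) (snd (F v))\<bar> \<le> e}" for e
  have cX: "compactin (mtopology_of X) (mspace X)" and cY: "compactin (mtopology_of Y) (mspace Y)"
    using X Y by (simp_all add: compact_metric_def compact_space_def)
  have A: "A u \<subseteq> mspace X \<times> mspace Y" if "u \<in> I" for u
    using that by (auto simp: I_def A_def)
  have top: "topspace P = Pi\<^sub>E I A"
    unfolding P_def topspace_product_topology using A by (intro PiE_cong) auto
  have "compactin ?T (A u)" if "u \<in> I" for u
    using that cX cY by (auto simp: I_def A_def compactin_Times)
  then have P: "compact_space P"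
    unfolding P_def compact_space_product_topology by (simp add: compact_space_subtopology)
  have cont: "continuous_map P ?T (\<lambda>F. F u)" if "u \<in> I" for u
    using continuous_map_product_projection[OF that, of "\<lambda>u. subtopology ?T (A u)"]
    by (simp add: P_def continuous_map_in_subtopology)
  have "I \<noteq> {}" using X by (auto simp: I_def compact_metric_def)
  have closed: "closedin P (C e)" for e
  proof -
    have "C e = (\<Inter>p\<in>I \<times> I. {F \<in> topspace P.
      \<bar>mdist X (fst (F (fst p))) (fst (F (snd p))) - mdist Y (snd (F (fst p))) (snd (F (snd p)))\<bar> \<le> e})"
      using \<open>I \<noteq> {}\<close> by (auto simp: C_def)
    also have "closedin P \<dots>"
      using \<open>I \<noteq> {}\<close> by (intro closedin_INT closedin_distortion_le cont) auto
    finally show ?thesis .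
  qed
  have nonempty: "C e \<noteq> {}" if "e > 2 * ?d" for e
  proof -
    have "?d < e / 2" using that by simp
    then obtain r S where r: "r < e / 2" "correspondence X Y (2 * r) S"
      unfolding gh_distance_less_iff[OF X Y] by blast
    have "correspondence X Y e S" by (rule correspondence_mono[OF r(2)]) (use r in simp)
    then have S: "S \<subseteq> mspace X \<times> mspace Y" "fst ` S = mspace X" "snd ` S = mspace Y"
      and dis: "\<And>x y x' y'. \<lbrakk>(x, y) \<in> S; (x', y') \<in> S\<rbrakk> \<Longrightarrow> \<bar>mdist X x x' - mdist Y y y'\<bar> \<le> e"
      unfolding correspondence_def by auto
    have "\<exists>p. p \<in> S \<and> p \<in> A u" if "u \<in> I" for u
    proof (cases u)
      case (Inl x)
      then have "x \<in> fst ` S" using that S by (auto simp: I_def)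
      then show ?thesis using S(1) Inl by (force simp: A_def)
    next
      case (Inr y)
      then have "y \<in> snd ` S" using that S by (auto simp: I_def)
      then show ?thesis using S(1) Inr by (force simp: A_def)
    qed
    then obtain F where F: "\<And>u. u \<in> I \<Longrightarrow> F u \<in> S \<and> F u \<in> A u" by metis
    have "restrict F I \<in> C e"
      using F dis by (auto simp: C_def top)
    then show ?thesis by blast
  qed
  have "(\<Inter>n. C (2 * ?d + 1 / real (Suc n))) \<noteq> {}"
  proof (rule compact_space_imp_nest[OF P])
    show "decseq (\<lambda>n. C (2 * ?d + 1 / real (Suc n)))"
    proof (rule decseq_SucI)
      fix n
      have "1 / real (Suc (Suc n)) \<le> 1 / real (Suc n)" by (simp add: frac_le)
      then show "C (2 * ?d + 1 / real (Suc (Suc n))) \<subseteq> C (2 * ?d + 1 / real (Suc n))"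
        unfolding C_def by (smt (verit, best) Collect_mono)
    qed
  qed (simp_all add: closed nonempty)
  then obtain F where F: "\<And>n. F \<in> C (2 * ?d + 1 / real (Suc n))" by blast
  have FA: "F u \<in> A u" if "u \<in> I" for u using F[of 0] that by (auto simp: C_def top)
  have "correspondence X Y (2 * ?d) (F ` I)"
    unfolding correspondence_def
  proof (intro conjI allI impI)
    show sub: "F ` I \<subseteq> mspace X \<times> mspace Y" using FA A by blast
    have "Inl x \<in> I \<and> x = fst (F (Inl x))" if "x \<in> mspace X" for x
    proof -
      have "Inl x \<in> I" using that by (auto simp: I_def)
      then show ?thesis using FA[of "Inl x"] by (auto simp: A_def)
    qed
    then show "fst ` F ` I = mspace X" using sub by (fastforce simp: image_image)
    have "Inr y \<in> I \<and> y = snd (F (Inr y))" if "y \<in> mspace Y" for y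
    proof -
      have "Inr y \<in> I" using that by (auto simp: I_def)
      then show ?thesis using FA[of "Inr y"] by (auto simp: A_def)
    qed
    then show "snd ` F ` I = mspace Y" using sub by (fastforce simp: image_image)
    fix x y x' y' assume "(x, y) \<in> F ` I" "(x', y') \<in> F ` I"
    then obtain u v where uv: "u \<in> I" "v \<in> I" "F u = (x, y)" "F v = (x', y')" by (metis imageE)
    show "\<bar>mdist X x x' - mdist Y y y'\<bar> \<le> 2 * ?d"
    proof (rule field_le_epsilon)
      fix e :: real assume "e > 0"
      then obtain n where "1 / real (Suc n) < e" using nat_approx_posE by metis
      moreover have "\<bar>mdist X x x' - mdist Y y y'\<bar> \<le> 2 * ?d + 1 / real (Suc n)"
        using F[of n] uv unfolding C_def by force
      ultimately show "\<bar>mdist X x x' - mdist Y y y'\<bar> \<le> 2 * ?d + e" by linarith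
    qed
  qed
  from that[OF correspondence_closure_of[OF this]] show thesis by simp
qed


section \<open>Thickened midpoints\<close>

text \<open>The copy number is the second component of a point. The averaged metric on \<open>R\<close> is combined by
  a maximum with the discrete metric of value \<open>c\<close> on the copy numbers.\<close>

definition thick_dist :: "'a metric \<Rightarrow> 'b metric \<Rightarrow> real \<Rightarrow> ('a \<times> 'b) \<times> nat \<Rightarrow> ('a \<times> 'b) \<times> nat \<Rightarrow> real"
  where "thick_dist X Y c p q =
    max ((mdist X (fst (fst p)) (fst (fst q)) + mdist Y (snd (fst p)) (snd (fst q))) / 2)
        (if snd p = snd q then 0 else c)"

definition thick_midpoint :: "'a metric \<Rightarrow> 'b metric \<Rightarrow> real \<Rightarrow> ('a \<times> 'b) set \<Rightarrow> nat \<Rightarrow> (('a \<times> 'b) \<times> nat) metric"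
  where "thick_midpoint X Y c R n = metric (R \<times> {..n}, thick_dist X Y c)"

lemma Metric_space_thick_dist:
  assumes R: "R \<subseteq> mspace X \<times> mspace Y" and "c > 0"
  shows "Metric_space (R \<times> {..n}) (thick_dist X Y c)"
proof
  show "0 \<le> thick_dist X Y c p q" for p q
    by (simp add: thick_dist_def le_max_iff_disj)
  show "thick_dist X Y c p q = thick_dist X Y c q p" for p q
    by (simp add: thick_dist_def mdist_commute)
  show "thick_dist X Y c p q = 0 \<longleftrightarrow> p = q" if "p \<in> R \<times> {..n}" "q \<in> R \<times> {..n}" for p q
  proof
    assume 0: "thick_dist X Y c p q = 0"
    then have "snd p = snd q" using \<open>c > 0\<close> by (auto simp: thick_dist_def split: if_splits)
    moreover have "mdist X (fst (fst p)) (fst (fst q)) = 0 \<and> mdist Y (snd (fst p)) (snd (fst q)) = 0"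
      using 0 mdist_nonneg[of X "fst (fst p)" "fst (fst q)"] mdist_nonneg[of Y "snd (fst p)" "snd (fst q)"]
      unfolding thick_dist_def by (smt (verit) divide_pos_pos)
    ultimately show "p = q" using that R by (auto simp: prod_eq_iff subset_iff)
  next
    assume "p = q"
    moreover have "fst (fst p) \<in> mspace X" "snd (fst p) \<in> mspace Y" using that(1) R by auto
    then have "mdist X (fst (fst p)) (fst (fst p)) = 0" "mdist Y (snd (fst p)) (snd (fst p)) = 0"
      by simp_all
    ultimately show "thick_dist X Y c p q = 0" by (simp add: thick_dist_def)
  qed
  show "thick_dist X Y c p s \<le> thick_dist X Y c p q + thick_dist X Y c q s"
    if "p \<in> R \<times> {..n}" "q \<in> R \<times> {..n}" "s \<in> R \<times> {..n}" for p q s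
  proof -
    have m: "fst (fst t) \<in> mspace X" "snd (fst t) \<in> mspace Y" if "t \<in> R \<times> {..n}" for t
      using that R by auto
    let ?a = "\<lambda>p q. (mdist X (fst (fst p)) (fst (fst q)) + mdist Y (snd (fst p)) (snd (fst q))) / 2"
    let ?b = "\<lambda>p q :: ('a \<times> 'b) \<times> nat. if snd p = snd q then 0 else c"
    have "?a p s \<le> ?a p q + ?a q s"
      using mdist_triangle[OF m(1)[OF that(1)] m(1)[OF that(2)] m(1)[OF that(3)]]
        mdist_triangle[OF m(2)[OF that(1)] m(2)[OF that(2)] m(2)[OF that(3)]]
      by (simp add: field_simps)
    moreover have "?b p s \<le> ?b p q + ?b q s" using \<open>c > 0\<close> by auto
    ultimately show ?thesis unfolding thick_dist_def by linarith
  qed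
qed

lemma thick_midpoint_simps:
  assumes "R \<subseteq> mspace X \<times> mspace Y" "c > 0"
  shows "mspace (thick_midpoint X Y c R n) = R \<times> {..n}"
    and "mdist (thick_midpoint X Y c R n) = thick_dist X Y c"
proof -
  interpret Metric_space "R \<times> {..n}" "thick_dist X Y c" by (rule Metric_space_thick_dist[OF assms])
  show "mspace (thick_midpoint X Y c R n) = R \<times> {..n}"
    "mdist (thick_midpoint X Y c R n) = thick_dist X Y c" by (simp_all add: thick_midpoint_def)
qed

text \<open>If a metric on a compact space is continuous in its second argument, then its balls are open,
  so the identity map carries compactness over to the metric topology.\<close>

lemma compact_space_mtopology_if_continuous:
  assumes "Metric_space (topspace T) D" "compact_space T"
    and cont: "\<And>p. p \<in> topspace T \<Longrightarrow> continuous_map T euclideanreal (D p)"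
  shows "compact_space (Metric_space.mtopology (topspace T) D)"
proof -
  interpret Metric_space "topspace T" D by fact
  have "continuous_map T mtopology id"
    unfolding continuous_map_to_metric
  proof (intro ballI allI impI)
    fix p and e :: real assume p: "p \<in> topspace T" "e > 0"
    have "openin T {q \<in> topspace T. D p q \<in> {..<e}}"
      by (rule openin_continuous_map_preimage[OF cont[OF p(1)]]) simp
    then show "\<exists>U. openin T U \<and> p \<in> U \<and> (\<forall>q\<in>U. id q \<in> mball (id p) e)"
      using p by (intro exI[of _ "{q \<in> topspace T. D p q \<in> {..<e}}"]) auto
  qed
  from image_compactin[OF assms(2)[unfolded compact_space_def] this]
  show ?thesis by (simp add: compact_space_def)
qed

lemma compact_metric_thick_midpoint:
  assumes X: "compact_metric X" and Y: "compact_metric Y" and "c > 0" "R \<noteq> {}"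
    and R: "closedin (prod_topology (mtopology_of X) (mtopology_of Y)) R"
  shows "compact_metric (thick_midpoint X Y c R n)"
proof -
  let ?T = "prod_topology (mtopology_of X) (mtopology_of Y)"
  let ?Z = "prod_topology (subtopology ?T R) (discrete_topology {..n})"
  have sub: "R \<subseteq> mspace X \<times> mspace Y" using closedin_subset[OF R] by simp
  interpret Metric_space "R \<times> {..n}" "thick_dist X Y c"
    by (rule Metric_space_thick_dist[OF sub \<open>c > 0\<close>])
  have top: "topspace ?Z = R \<times> {..n}" using sub by auto
  have "compact_space ?T"
    using X Y by (simp add: compact_space_prod_topology compact_metric_def)
  then have "compact_space (subtopology ?T R)"
    using R closedin_compact_space compact_space_subtopology by blast
  then have Z: "compact_space ?Z" by (simp add: compact_space_prod_topology compact_space_discrete_topology)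
  have fst: "continuous_map ?Z ?T fst"
    using continuous_map_fst[of "subtopology ?T R" "discrete_topology {..n}"]
    by (simp add: continuous_map_in_subtopology)
  have cX: "continuous_map ?Z (mtopology_of X) (\<lambda>q. fst (fst q))"
    and cY: "continuous_map ?Z (mtopology_of Y) (\<lambda>q. snd (fst q))"
    using continuous_map_compose[OF fst continuous_map_fst]
      continuous_map_compose[OF fst continuous_map_snd] by (simp_all add: o_def)
  have "continuous_map ?Z euclideanreal (thick_dist X Y c p)" if p: "p \<in> topspace ?Z" for p
  proof -
    have "continuous_map (discrete_topology {..n}) euclideanreal (\<lambda>i. if snd p = i then 0 else c)"
      by simp
    from continuous_map_compose[OF continuous_map_snd this, of "subtopology ?T R"]
    have "continuous_map ?Z euclideanreal (\<lambda>q. if snd p = snd q then 0 else c)"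
      by (simp add: o_def)
    moreover have "fst (fst p) \<in> mspace X" "snd (fst p) \<in> mspace Y" using p by auto
    ultimately show ?thesis
      unfolding thick_dist_def
      by (intro continuous_map_real_max continuous_map_real_divide continuous_map_add
            continuous_map_mdist cX cY) auto
  qed
  then have "compact_space mtopology"
    using compact_space_mtopology_if_continuous[of ?Z "thick_dist X Y c"] Z Metric_space_axioms
    unfolding top by blast
  then show ?thesis
    using \<open>R \<noteq> {}\<close> by (auto simp: compact_metric_def thick_midpoint_def mtopology_of_def)
qed

text \<open>With \<open>a\<close> and \<open>b\<close> the distances in \<open>X\<close> and \<open>Y\<close>, the average \<open>(a + b) / 2\<close> is within \<open>c\<close> of both
  because \<open>\<bar>a - b\<bar> \<le> 2 * c\<close>; the maximum with \<open>c\<close> does no harm because \<open>c \<le> a + c\<close> and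
  \<open>c \<le> b + c\<close>.\<close>

lemma gh_distance_thick_midpoint_le:
  assumes X: "compact_metric X" and Y: "compact_metric Y" and "c > 0"
    and corr: "correspondence X Y (2 * c) R"
    and R: "closedin (prod_topology (mtopology_of X) (mtopology_of Y)) R"
  shows "gh_distance X (thick_midpoint X Y c R n) \<le> c / 2"
    and "gh_distance Y (thick_midpoint X Y c R n) \<le> c / 2"
proof -
  let ?M = "thick_midpoint X Y c R n"
  have sub: "R \<subseteq> mspace X \<times> mspace Y" "fst ` R = mspace X" "snd ` R = mspace Y"
    and dis: "\<And>x y x' y'. \<lbrakk>(x, y) \<in> R; (x', y') \<in> R\<rbrakk> \<Longrightarrow> \<bar>mdist X x x' - mdist Y y y'\<bar> \<le> 2 * c"
    using corr unfolding correspondence_def by auto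
  note M = thick_midpoint_simps[OF sub(1) \<open>c > 0\<close>, of n]
  have "R \<noteq> {}" using sub X by (auto simp: compact_metric_def)
  then have cM: "compact_metric ?M" by (intro compact_metric_thick_midpoint X Y R \<open>c > 0\<close>)
  have near: "\<bar>mdist X (fst (fst p)) (fst (fst q)) - thick_dist X Y c p q\<bar> \<le> c"
    "\<bar>mdist Y (snd (fst p)) (snd (fst q)) - thick_dist X Y c p q\<bar> \<le> c"
    if "p \<in> R \<times> {..n}" "q \<in> R \<times> {..n}" for p q
  proof -
    let ?a = "mdist X (fst (fst p)) (fst (fst q))" and ?b = "mdist Y (snd (fst p)) (snd (fst q))"
    have "\<bar>?a - ?b\<bar> \<le> 2 * c" using that by (intro dis) auto
    moreover have "0 \<le> ?a" "0 \<le> ?b" by simp_all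
    ultimately show "\<bar>?a - thick_dist X Y c p q\<bar> \<le> c" "\<bar>?b - thick_dist X Y c p q\<bar> \<le> c"
      using \<open>c > 0\<close> by (auto simp: thick_dist_def max_def abs_le_iff field_simps)
  qed
  have fst_thick: "fst ` (R \<times> {..n}) = R" by simp
  have corr_X: "correspondence X ?M (2 * (c / 2)) ((\<lambda>p. (fst (fst p), p)) ` (R \<times> {..n}))"
    unfolding correspondence_def M
  proof (intro conjI allI impI)
    have "fst ` fst ` (R \<times> {..n}) = mspace X" unfolding fst_thick by (rule sub)
    then show "fst ` (\<lambda>p. (fst (fst p), p)) ` (R \<times> {..n}) = mspace X" by (simp only: image_image fst_conv)
  qed (use sub near in \<open>auto simp: image_image\<close>)
  have corr_Y: "correspondence Y ?M (2 * (c / 2)) ((\<lambda>p. (snd (fst p), p)) ` (R \<times> {..n}))"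
    unfolding correspondence_def M
  proof (intro conjI allI impI)
    have "snd ` fst ` (R \<times> {..n}) = mspace Y" unfolding fst_thick by (rule sub)
    then show "fst ` (\<lambda>p. (snd (fst p), p)) ` (R \<times> {..n}) = mspace Y" by (simp only: image_image fst_conv)
  qed (use sub near in \<open>auto simp: image_image\<close>)
  show "gh_distance X ?M \<le> c / 2"
    by (rule gh_distance_le_correspondence[OF X cM corr_X half_gt_zero[OF \<open>c > 0\<close>]])
  show "gh_distance Y ?M \<le> c / 2"
    by (rule gh_distance_le_correspondence[OF Y cM corr_Y half_gt_zero[OF \<open>c > 0\<close>]])
qed


section \<open>Separated sets\<close>

text \<open>Points at mutual distance at least \<open>e\<close> lie in different members of a finite cover by balls of
  radius \<open>e / 2\<close>.\<close>

lemma compact_metric_separated_bound: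
  assumes W: "compact_metric W" and "e > 0"
  obtains N where "\<And>f I. \<lbrakk>f ` I \<subseteq> mspace W; \<And>i j. \<lbrakk>i \<in> I; j \<in> I; i \<noteq> j\<rbrakk> \<Longrightarrow> e \<le> mdist W (f i) (f j)\<rbrakk>
    \<Longrightarrow> card I \<le> N"
proof -
  interpret W: Metric_space "mspace W" "mdist W" by simp
  have "W.mtotally_bounded (mspace W)"
    using W W.compactin_imp_mtotally_bounded[of "mspace W"]
    by (simp add: compact_metric_def compact_space_def mtopology_of_def)
  from this[unfolded W.mtotally_bounded_def, rule_format, OF half_gt_zero[OF \<open>e > 0\<close>]]
  obtain K where K: "finite K" "mspace W \<subseteq> (\<Union>x\<in>K. W.mball x (e / 2))" by blast
  show thesis
  proof (rule that)
    fix f and I :: "'b set"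
    assume f: "f ` I \<subseteq> mspace W"
      and sep: "\<And>i j. \<lbrakk>i \<in> I; j \<in> I; i \<noteq> j\<rbrakk> \<Longrightarrow> e \<le> mdist W (f i) (f j)"
    have "\<forall>i\<in>I. \<exists>k\<in>K. f i \<in> W.mball k (e / 2)" using f K(2) by blast
    then obtain k where k: "\<And>i. i \<in> I \<Longrightarrow> k i \<in> K \<and> f i \<in> W.mball (k i) (e / 2)" by metis
    have "inj_on k I"
    proof (rule inj_onI, rule ccontr)
      fix i j assume ij: "i \<in> I" "j \<in> I" "k i = k j" "i \<noteq> j"
      then have "mdist W (f i) (f j) < e"
        using k[of i] k[of j] mdist_triangle[of "f i" W "k i" "f j"]
        by (auto simp: mdist_commute)
      then show False using sep ij by fastforce
    qed
    then show "card I \<le> card K" using k K(1) by (intro card_inj_on_le) auto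
  qed
qed

text \<open>A correspondence of distortion less than \<open>e / 2\<close> turns \<open>e\<close>-separated points of \<open>Z\<close> into
  \<open>e / 2\<close>-separated points of \<open>W\<close>, so the bound for \<open>W\<close> is uniform in all \<open>Z\<close> near \<open>W\<close>.\<close>

lemma gh_distance_separated_bound:
  fixes W :: "'a metric"
  assumes W: "compact_metric W" and "e > 0"
  obtains N where "\<And>(Z :: 'b metric) f I.
    \<lbrakk>compact_metric Z; gh_distance Z W < e / 4; f ` I \<subseteq> mspace Z;
      \<And>i j. \<lbrakk>i \<in> I; j \<in> I; i \<noteq> j\<rbrakk> \<Longrightarrow> e \<le> mdist Z (f i) (f j)\<rbrakk> \<Longrightarrow> card I \<le> N"
proof -
  obtain N where N: "\<And>f (I :: 'c set). \<lbrakk>f ` I \<subseteq> mspace W;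
      \<And>i j. \<lbrakk>i \<in> I; j \<in> I; i \<noteq> j\<rbrakk> \<Longrightarrow> e / 2 \<le> mdist W (f i) (f j)\<rbrakk> \<Longrightarrow> card I \<le> N"
    using compact_metric_separated_bound[OF W half_gt_zero[OF \<open>e > 0\<close>]] by metis
  show thesis
  proof (rule that)
    fix Z :: "'b metric" and f and I :: "'c set"
    assume Z: "compact_metric Z" "gh_distance Z W < e / 4" "f ` I \<subseteq> mspace Z"
      and sep: "\<And>i j. \<lbrakk>i \<in> I; j \<in> I; i \<noteq> j\<rbrakk> \<Longrightarrow> e \<le> mdist Z (f i) (f j)"
    obtain r R where r: "r < e / 4" "correspondence Z W (2 * r) R"
      using Z(2) unfolding gh_distance_less_iff[OF Z(1) W] by blast
    then have R: "R \<subseteq> mspace Z \<times> mspace W" "fst ` R = mspace Z"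
      and dis: "\<And>x y x' y'. \<lbrakk>(x, y) \<in> R; (x', y') \<in> R\<rbrakk> \<Longrightarrow> \<bar>mdist Z x x' - mdist W y y'\<bar> \<le> 2 * r"
      unfolding correspondence_def by auto
    have "\<forall>i\<in>I. \<exists>w. (f i, w) \<in> R" using Z(3) R(2) by force
    then obtain g where g: "\<And>i. i \<in> I \<Longrightarrow> (f i, g i) \<in> R" by metis
    show "card I \<le> N"
    proof (rule N)
      show "g ` I \<subseteq> mspace W" using g R(1) by blast
      show "e / 2 \<le> mdist W (g i) (g j)" if "i \<in> I" "j \<in> I" "i \<noteq> j" for i j
        using dis[OF g[OF that(1)] g[OF that(2)]] sep[OF that] r(1) by linarith
    qed
  qed
qed


section \<open>Metric segments are not compact\<close>

lemma compact_metric_rep: "compact_metric (rep_gh_space Z)"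
  using Quotient3_rep_reflp[OF Quotient3_gh_space] by blast

text \<open>Points of \<open>gh_space\<close> are represented on sets of real numbers, whereas the thickened midpoint
  lives on a product type; this brings it into \<open>gh_space\<close>.\<close>

lemma gh_space_representative:
  fixes M :: "'a metric"
  assumes "compact_metric M"
  obtains Z where "isometric M (rep_gh_space Z)"
proof -
  obtain N :: "real metric" where N: "compact_metric N" "isometric M N"
    using compact_metric_isometric_real[OF assms] by blast
  have "isometric (rep_gh_space (abs_gh_space N)) N"
    using Quotient3_rep_abs[OF Quotient3_gh_space, of N] N(1) isometric_refl by blast
  then show thesis using that N(2) isometric_trans isometric_sym by metis
qed

lemma gh_distance_isometric_right_le:
  assumes "compact_metric X" "compact_metric Y" "isometric Y Z"
  shows "gh_distance X Z \<le> gh_distance X Y"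
proof -
  have Z: "compact_metric Z" by (rule isometric_compact_metric[OF assms(3,2)])
  have "gh_distance Y Z = 0" using gh_distance_eq_0_iff[OF assms(2) Z] assms(3) by simp
  then show ?thesis using gh_distance_triangle[OF assms(1,2) Z] by simp
qed

text \<open>The space is the thickened midpoint for an optimal correspondence, with \<open>c\<close> the full distance
  of \<open>X\<close> and \<open>Y\<close>. Its distances to the ends are at most half of \<open>c\<close>, so the triangle inequality
  puts it on the segment. The separated points are the copies of a single pair.\<close>

lemma metric_segment_contains_separated:
  fixes X Y :: gh_space and n :: nat
  assumes "X \<noteq> Y"
  shows "\<exists>Z f. Z \<in> metric_segment X Y \<and> f ` {..n} \<subseteq> mspace (rep_gh_space Z) \<and>
    (\<forall>i\<in>{..n}. \<forall>j\<in>{..n}. i \<noteq> j \<longrightarrow> dist X Y \<le> mdist (rep_gh_space Z) (f i) (f j))"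
proof -
  let ?X = "rep_gh_space X" and ?Y = "rep_gh_space Y" and ?c = "dist X Y"
  have c: "?c > 0" using assms by simp
  note cX = compact_metric_rep[of X] and cY = compact_metric_rep[of Y]
  obtain R where corr: "correspondence ?X ?Y (2 * ?c) R"
    and R: "closedin (prod_topology (mtopology_of ?X) (mtopology_of ?Y)) R"
    using optimal_correspondence_exists[OF cX cY] unfolding dist_gh_space.rep_eq by blast
  let ?M = "thick_midpoint ?X ?Y ?c R n"
  have sub: "R \<subseteq> mspace ?X \<times> mspace ?Y" and "R \<noteq> {}"
    using corr cX by (auto simp: correspondence_def compact_metric_def)
  then obtain p where p: "p \<in> R" by blast
  have cM: "compact_metric ?M" by (rule compact_metric_thick_midpoint[OF cX cY c \<open>R \<noteq> {}\<close> R])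
  note M = thick_midpoint_simps[OF sub c, of n]
  obtain Z where Z: "isometric ?M (rep_gh_space Z)" using gh_space_representative[OF cM] by blast
  then obtain h where h: "bij_betw h (R \<times> {..n}) (mspace (rep_gh_space Z))"
    and hd: "\<And>p q. \<lbrakk>p \<in> R \<times> {..n}; q \<in> R \<times> {..n}\<rbrakk> \<Longrightarrow>
      mdist (rep_gh_space Z) (h p) (h q) = thick_dist ?X ?Y ?c p q"
    unfolding isometric_def M by blast
  have "dist X Z \<le> ?c / 2" "dist Y Z \<le> ?c / 2"
    unfolding dist_gh_space.rep_eq[of X Z] dist_gh_space.rep_eq[of Y Z]
    using gh_distance_isometric_right_le[OF cX cM Z] gh_distance_isometric_right_le[OF cY cM Z]
      gh_distance_thick_midpoint_le[OF cX cY c corr R, of n] by linarith+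
  then have "Z \<in> metric_segment X Y"
    using dist_triangle[of X Y Z] unfolding metric_segment_def by (simp add: dist_commute)
  moreover have "(\<lambda>i. h (p, i)) ` {..n} \<subseteq> mspace (rep_gh_space Z)"
    using p bij_betwE[OF h] by blast
  moreover have "?c \<le> mdist (rep_gh_space Z) (h (p, i)) (h (p, j))"
    if "i \<in> {..n}" "j \<in> {..n}" "i \<noteq> j" for i j
    using that p by (simp add: hd thick_dist_def)
  ultimately show ?thesis by (intro exI[of _ Z] exI[of _ "\<lambda>i. h (p, i)"]) blast
qed

theorem corollary2:
  fixes X Y :: gh_space
  assumes "X \<noteq> Y"
  shows "\<not> compact (metric_segment X Y)"
proof
  assume "compact (metric_segment X Y)"
  then have seq: "seq_compact (metric_segment X Y)" by (rule compact_imp_seq_compact)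
  define separated where "separated Z f n \<longleftrightarrow> f ` {..n} \<subseteq> mspace (rep_gh_space Z) \<and>
    (\<forall>i\<in>{..n}. \<forall>j\<in>{..n}. i \<noteq> j \<longrightarrow> dist X Y \<le> mdist (rep_gh_space Z) (f i) (f j))"
    for Z and f :: "nat \<Rightarrow> real" and n
  have "\<forall>n. \<exists>Z f. Z \<in> metric_segment X Y \<and> separated Z f n"
    unfolding separated_def by (intro allI metric_segment_contains_separated[OF assms])
  then obtain Z f where Z: "\<And>n. Z n \<in> metric_segment X Y"
    and "\<And>n. separated (Z n) (f n) n" by metis
  then have f: "\<And>n. f n ` {..n} \<subseteq> mspace (rep_gh_space (Z n))"
    and sep: "\<And>n i j. \<lbrakk>i \<in> {..n}; j \<in> {..n}; i \<noteq> j\<rbrakk> \<Longrightarrow>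
      dist X Y \<le> mdist (rep_gh_space (Z n)) (f n i) (f n j)"
    unfolding separated_def by blast+
  obtain W s where s: "strict_mono (s :: nat \<Rightarrow> nat)" and lim: "(Z \<circ> s) \<longlonglongrightarrow> W"
    using seq_compactE[OF seq] Z by metis
  have pos: "dist X Y > 0" using assms by simp
  obtain N where N: "\<And>(A :: real metric) g (I :: nat set).
    \<lbrakk>compact_metric A; gh_distance A (rep_gh_space W) < dist X Y / 4; g ` I \<subseteq> mspace A;
      \<And>i j. \<lbrakk>i \<in> I; j \<in> I; i \<noteq> j\<rbrakk> \<Longrightarrow> dist X Y \<le> mdist A (g i) (g j)\<rbrakk> \<Longrightarrow> card I \<le> N"
    using gh_distance_separated_bound[OF compact_metric_rep[of W] pos] by metis
  have "\<forall>\<^sub>F k in sequentially. dist ((Z \<circ> s) k) W < dist X Y / 4"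
    by (rule tendstoD[OF lim]) (use pos in simp)
  then obtain k where k: "k \<ge> N" "dist (Z (s k)) W < dist X Y / 4"
    unfolding eventually_sequentially comp_apply by (metis nle_le)
  have "card {..s k} \<le> N"
    using k(2) by (intro N[OF compact_metric_rep _ f sep]) (auto simp: dist_gh_space.rep_eq)
  moreover have "k \<le> s k" using s by (rule strict_mono_imp_increasing)
  ultimately show False using k(1) by simp
qed

end
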